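(* Let $\boldsymbol{\eta}=\{\eta_n\}_{n=0}^\infty$ be a sequence of complex numbers. Then the following conditions are equivalent. (i) The Cesàro type operator $\mathcal{C}_{\boldsymbol{\eta}}$ is bounded on the Dirichlet space $\mathcal{D}$. (ii) $\sup_{t\in[0,1)}\|\mathcal{C}_{\boldsymbol{\eta}}k_t\|_{\mathcal{D}}<\infty$, where $k_t$ is the normalized reproducing kernel of $\mathcal{D}$ at $t\in[0,1)$. (iii) $\displaystyle\sum_{n=m}^\infty n|\eta_n|^2=O\left(\frac{1}{\log(m+2)}\right)$, i.e. there is a constant $C$ with $\sum_{n=m}^\infty n|\eta_n|^2\le\frac{C}{\log(m+2)}$ for all $m\in\mathbb{N}$.
   Context: $\mathbb{N}$ is the set of nonnegative integers, $\mathbb{D}$ is the open unit disk, $H(\mathbb{D})$ is the space of analytic functions on $\mathbb{D}$, and $dA=\pi^{-1}dx\,dy$ is normalized Lebesgue measure on $\mathbb{D}$. The Dirichlet space $\mathcal{D}$ is the Hilbert space of $f\in H(\mathbb{D})$ with $\|f\|_{\mathcal{D}}^2=|f(0)|^2+\int_{\mathbb{D}}|f'(z)|^2dA(z)<\infty$. Its reproducing kernel at $w\in\mathbb{D}$ is $K_w(z)=1+\log\frac{1}{1-z\overline{w}}$, and the normalized reproducing kernel is $k_w(z)=K_w(z)/\sqrt{K_w(w)}$. For $f(z)=\sum_{n\ge0}a_nz^n\in H(\mathbb{D})$, the Cesàro type operator is $\mathcal{C}_{\boldsymbol{\eta}}(f)(z)=\sum_{n=0}^\infty\left(\eta_n\sum_{k=0}^na_k\right)z^n$,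 whenever the right-hand side makes sense and defines an analytic function in $\mathbb{D}$. It is bounded on $\mathcal{D}$ if $\mathcal{C}_{\boldsymbol{\eta}}(f)$ is well defined in $H(\mathbb{D})$ for every $f\in\mathcal{D}$ and there is a constant $C>0$ with $\|\mathcal{C}_{\boldsymbol{\eta}}(f)\|_{\mathcal{D}}\le C\|f\|_{\mathcal{D}}$ for all $f\in\mathcal{D}$. In (ii), the norm is understood to be $+\infty$ if $\mathcal{C}_{\boldsymbol{\eta}}k_t$ is not a well-defined element of $\mathcal{D}$. *)

theory Defs
  imports "HOL-Complex_Analysis.Complex_Analysis"
begin

abbreviation unit_disc :: "complex set" where
  "unit_disc \<equiv> ball 0 1"

(* Functions on the disc are represented by total functions on the complex plane;
   none of the definitions below looks at values outside the disc. *)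

definition disc_area :: "complex measure" where
  "disc_area = scale_measure (ennreal (1 / pi)) (restrict_space lborel unit_disc)"

definition dirichlet_sqnorm :: "(complex \<Rightarrow> complex) \<Rightarrow> ennreal" where
  "dirichlet_sqnorm f =
     ennreal ((norm (f 0))\<^sup>2) + (\<integral>\<^sup>+ z. ennreal ((norm (deriv f z))\<^sup>2) \<partial>disc_area)"

definition dirichlet_space :: "(complex \<Rightarrow> complex) set" where
  "dirichlet_space = {f. f holomorphic_on unit_disc \<and> dirichlet_sqnorm f < \<infinity>}"

(* Meaningful on dirichlet_space only: enn2real sends infinity to 0. *)
definition dirichlet_norm :: "(complex \<Rightarrow> complex) \<Rightarrow> real" where
  "dirichlet_norm f = sqrt (enn2real (dirichlet_sqnorm f))"

(* Principal branch: Re (1 - z * cnj w) > 0 for z, w in the disc. *)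
definition dirichlet_kernel :: "complex \<Rightarrow> complex \<Rightarrow> complex" where
  "dirichlet_kernel w z = 1 + Ln (1 / (1 - z * cnj w))"

(* The value of the kernel at (w, w) is real and at least 1, so Re only changes the type. *)
definition normalized_dirichlet_kernel :: "complex \<Rightarrow> complex \<Rightarrow> complex" where
  "normalized_dirichlet_kernel w z =
     dirichlet_kernel w z / complex_of_real (sqrt (Re (dirichlet_kernel w w)))"

definition cesaro_coeff :: "(nat \<Rightarrow> complex) \<Rightarrow> (complex \<Rightarrow> complex) \<Rightarrow> nat \<Rightarrow> complex" where
  "cesaro_coeff \<eta> f n = \<eta> n * (\<Sum>k\<le>n. fps_nth (fps_expansion f 0) k)"

definition cesaro :: "(nat \<Rightarrow> complex) \<Rightarrow> (complex \<Rightarrow> complex) \<Rightarrow> complex \<Rightarrow> complex" where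
  "cesaro \<eta> f z = (\<Sum>n. cesaro_coeff \<eta> f n * z ^ n)"

definition cesaro_well_defined :: "(nat \<Rightarrow> complex) \<Rightarrow> (complex \<Rightarrow> complex) \<Rightarrow> bool" where
  "cesaro_well_defined \<eta> f \<longleftrightarrow>
     (\<forall>z\<in>unit_disc. summable (\<lambda>n. cesaro_coeff \<eta> f n * z ^ n)) \<and>
     cesaro \<eta> f holomorphic_on unit_disc"

definition cesaro_bounded_on_dirichlet :: "(nat \<Rightarrow> complex) \<Rightarrow> bool" where
  "cesaro_bounded_on_dirichlet \<eta> \<longleftrightarrow>
     (\<forall>f\<in>dirichlet_space. cesaro_well_defined \<eta> f) \<and>
     (\<exists>C>0. \<forall>f\<in>dirichlet_space.
        cesaro \<eta> f \<in> dirichlet_space \<and>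
        dirichlet_norm (cesaro \<eta> f) \<le> C * dirichlet_norm f)"

definition cesaro_dirichlet_enorm ::
    "(nat \<Rightarrow> complex) \<Rightarrow> (complex \<Rightarrow> complex) \<Rightarrow> ennreal" where
  "cesaro_dirichlet_enorm \<eta> f =
     (if cesaro_well_defined \<eta> f \<and> cesaro \<eta> f \<in> dirichlet_space
      then ennreal (dirichlet_norm (cesaro \<eta> f)) else \<infinity>)"

end

theory Submission
  imports Defs
begin

text \<open>
  Orthogonality of the monomials under area measure gives
  \<open>\<parallel>f\<parallel>\<^sup>2 = \<Sum>n. max 1 n * |a\<^sub>n|\<^sup>2\<close>, so boundedness is the weighted discrete Hardy inequality
  \<open>\<Sum>n. n |\<eta>\<^sub>n|\<^sup>2 |a\<^sub>0 + \<dots> + a\<^sub>n|\<^sup>2 \<le> C \<parallel>f\<parallel>\<^sup>2\<close>. Its Muckenhoupt condition asks that the product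
  of the tail of \<open>n |\<eta>\<^sub>n|\<^sup>2\<close> beyond \<open>m\<close> with \<open>\<Sum>k\<le>m. 1 / max 1 k\<close>, which is comparable to
  \<open>ln (m + 2)\<close>, stays bounded; this is the tail condition. Conversely, at
  \<open>t = (m + 1) / (m + 2)\<close> the coefficients \<open>t\<^sup>k / max 1 k\<close> of the kernel have partial sums of
  order at least \<open>ln (m + 2)\<close> from \<open>m\<close> on, while its squared norm is at most of that order, so
  testing the operator on \<open>k\<^sub>t\<close> recovers the tail condition.
\<close>

section \<open>Translations, reflections and rotations of area measure\<close>

lemma nn_integral_lborel_translate:
  fixes h :: "'a::euclidean_space \<Rightarrow> ennreal"
  assumes [measurable]: "h \<in> borel_measurable borel"
  shows "(\<integral>\<^sup>+x. h (x - a) \<partial>lborel) = (\<integral>\<^sup>+x. h x \<partial>lborel)"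
  using nn_integral_distr[of "(+) (- a)" lborel borel h] by (simp add: lborel_distr_plus)

lemma nn_integral_lborel_reflect:
  fixes h :: "'a::euclidean_space \<Rightarrow> ennreal"
  assumes [measurable]: "h \<in> borel_measurable borel"
  shows "(\<integral>\<^sup>+x. h (a - x) \<partial>lborel) = (\<integral>\<^sup>+x. h x \<partial>lborel)"
proof -
  have "lborel = distr lborel borel (\<lambda>x::'a. a + (-1) *\<^sub>R x)"
    by (subst lborel_affine[of "-1" a]) (auto simp: density_1)
  then have "(\<integral>\<^sup>+x. h x \<partial>lborel) = (\<integral>\<^sup>+x. h x \<partial>distr lborel borel (\<lambda>x::'a. a + (-1) *\<^sub>R x))"
    by simp
  also have "\<dots> = (\<integral>\<^sup>+x. h (a - x) \<partial>lborel)"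
    by (subst nn_integral_distr) auto
  finally show ?thesis by simp
qed

text \<open>
  Since the unit ball \<open>B\<close> is invariant under rotations, Fubini identifies
  \<open>|B|\<close> times either side with the double integral of \<open>h (c x) * B (y - c x)\<close>.
\<close>

lemma nn_integral_lborel_rotate:
  fixes h :: "complex \<Rightarrow> ennreal"
  assumes [measurable]: "h \<in> borel_measurable borel" and c: "norm c = 1"
  shows "(\<integral>\<^sup>+x. h (c * x) \<partial>lborel) = (\<integral>\<^sup>+x. h x \<partial>lborel)"
proof -
  define B :: "complex \<Rightarrow> ennreal" where "B = indicator (ball 0 1)"
  have [measurable]: "B \<in> borel_measurable borel"
    unfolding B_def by (intro borel_measurable_indicator borel_open open_ball)
  have B_int: "(\<integral>\<^sup>+x. B x \<partial>lborel) = ennreal pi"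
    by (simp add: B_def emeasure_ball unit_ball_vol_2)
  have B_rot: "B (c * x) = B x" for x
    using c by (simp add: B_def indicator_def norm_mult)
  have cc: "c * (cnj c * y - x) = y - c * x" for x y
    using c by (simp add: complex_norm_square[symmetric] mult.assoc[symmetric] right_diff_distrib)
  have "(\<integral>\<^sup>+x. h (c * x) \<partial>lborel) * pi = (\<integral>\<^sup>+x. h (c * x) * (\<integral>\<^sup>+y. B (y - c * x) \<partial>lborel) \<partial>lborel)"
    by (simp add: nn_integral_lborel_translate B_int nn_integral_multc)
  also have "\<dots> = (\<integral>\<^sup>+x. (\<integral>\<^sup>+y. h (c * x) * B (y - c * x) \<partial>lborel) \<partial>lborel)"
    by (simp add: nn_integral_cmult)
  also have "\<dots> = (\<integral>\<^sup>+y. (\<integral>\<^sup>+x. h (c * x) * B (y - c * x) \<partial>lborel) \<partial>lborel)"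
    by (rule lborel_pair.Fubini'[symmetric]) simp
  \<comment> \<open>For fixed \<open>y\<close>, the reflection \<open>x\<close> to
    \<open>cnj c * y - x\<close> turns \<open>c * x\<close> into \<open>y - c * x\<close>. This
    swaps the arguments of \<open>h\<close> and \<open>B\<close>, and \<open>B_rot\<close> then
    removes \<open>c\<close> from \<open>B\<close>. The remaining integral in \<open>y\<close> is a
    translate and no longer sees \<open>c\<close>, and the finite nonzero factor pi cancels at the
    end.\<close>
  also have "\<dots> = (\<integral>\<^sup>+y. (\<integral>\<^sup>+x. h (c * (cnj c * y - x)) * B (y - c * (cnj c * y - x)) \<partial>lborel) \<partial>lborel)"
    by (subst nn_integral_lborel_reflect[of "\<lambda>x. h (c * x) * B (_ - c * x)"]) auto
  also have "\<dots> = (\<integral>\<^sup>+y. (\<integral>\<^sup>+x. B x * h (y - c * x) \<partial>lborel) \<partial>lborel)"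
    by (simp add: cc B_rot mult.commute[of _ "B _"])
  also have "\<dots> = (\<integral>\<^sup>+x. (\<integral>\<^sup>+y. B x * h (y - c * x) \<partial>lborel) \<partial>lborel)"
    by (rule lborel_pair.Fubini') simp
  also have "\<dots> = (\<integral>\<^sup>+x. h x \<partial>lborel) * pi"
    by (simp add: nn_integral_cmult nn_integral_lborel_translate nn_integral_multc B_int mult.commute)
  finally show ?thesis
    by (simp add: mult.commute[of _ "ennreal pi"] ennreal_mult_cancel_left)
qed

lemma lborel_distr_rotate:
  assumes "norm c = 1"
  shows "distr lborel borel ((*) c) = (lborel :: complex measure)"
proof (rule measure_eqI)
  fix A assume "A \<in> sets (distr lborel borel ((*) c))"
  then have [measurable]: "A \<in> sets borel" by simp
  have "emeasure (distr lborel borel ((*) c)) A = (\<integral>\<^sup>+x. indicator A (c * x) \<partial>lborel)"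
    using nn_integral_distr[of "(*) c" lborel borel "indicator A"] by simp
  also have "\<dots> = emeasure lborel A"
    by (subst nn_integral_lborel_rotate) (auto simp: assms)
  finally show "emeasure (distr lborel borel ((*) c)) A = emeasure lborel A" .
qed auto

section \<open>Area integrals of powers of the modulus over discs\<close>

text \<open>Stands in for polar coordinates: the squared modulus of a point of the disc is uniformly
  distributed up to the factor pi. A measure on the line that is finite on right half-lines is
  determined by them, and their preimages are the whole disc, an annulus of area pi (r^2 - x), or
  empty.\<close>

lemma distr_norm_square_ball:
  assumes "0 < r"
  shows "distr (restrict_space lborel (ball 0 r)) borel (\<lambda>z::complex. (norm z)\<^sup>2) =
    density lborel (\<lambda>x. ennreal pi * indicator {0..r\<^sup>2} x)" (is "?M = ?N")
proof (rule measure_eqI_lessThan)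
  have m[measurable]: "(\<lambda>z::complex. (norm z)\<^sup>2) \<in> borel_measurable (restrict_space lborel (ball 0 r))"
    by (rule measurable_restrict_space1) simp
  show "sets ?M = sets borel" "sets ?N = sets borel" by auto
  fix x :: real
  have M: "emeasure ?M {x<..} = emeasure lborel {z::complex. x < (norm z)\<^sup>2 \<and> norm z < r}"
  proof -
    have "(\<lambda>z::complex. (norm z)\<^sup>2) -` {x<..} \<inter> space (restrict_space lborel (ball 0 r)) =
      {z::complex. x < (norm z)\<^sup>2 \<and> norm z < r}"
      by (auto simp: space_restrict_space)
    then show ?thesis
      by (subst emeasure_distr) (auto intro!: emeasure_restrict_space)
  qed
  have N: "emeasure ?N {x<..} = ennreal pi * emeasure lborel ({0..r\<^sup>2} \<inter> {x<..})"
    by (subst emeasure_density) (auto simp: mult.assoc nn_integral_cmult indicator_inter_arith[symmetric] simp del: indicator_inter_arith)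
  have br: "emeasure lborel (ball 0 r :: complex set) = ennreal (pi * r\<^sup>2)"
    using assms by (simp add: emeasure_ball unit_ball_vol_2)
  show "emeasure ?M {x<..} = emeasure ?N {x<..}"
  proof (cases "x < 0")
    case True
    then have "{z::complex. x < (norm z)\<^sup>2 \<and> norm z < r} = ball 0 r"
      by (auto intro: less_le_trans)
    moreover have "{0..r\<^sup>2} \<inter> {x<..} = {0..r\<^sup>2}" using True by auto
    ultimately show ?thesis using br by (simp add: M N ennreal_mult)
  next
    case False
    show ?thesis
    proof (cases "x < r\<^sup>2")
      case True
      have sx: "0 \<le> sqrt x" "sqrt x < r" using True \<open>\<not> x < 0\<close> assms by (auto intro: real_less_lsqrt)
      have iff: "x < (norm z)\<^sup>2 \<longleftrightarrow> sqrt x < norm z" for z :: complex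
        using \<open>\<not> x < 0\<close> by (metis not_less norm_ge_zero real_sqrt_abs abs_norm_cancel real_sqrt_less_iff)
      have "{z::complex. x < (norm z)\<^sup>2 \<and> norm z < r} = ball 0 r - cball 0 (sqrt x)"
        by (auto simp: iff)
      also have "emeasure lborel \<dots> = emeasure lborel (ball 0 r :: complex set) - emeasure lborel (cball 0 (sqrt x) :: complex set)"
        using sx by (intro emeasure_Diff) (auto simp: emeasure_cball)
      also have "\<dots> = ennreal (pi * r\<^sup>2 - pi * x)"
        using sx \<open>\<not> x < 0\<close> by (simp add: br emeasure_cball unit_ball_vol_2 ennreal_minus)
      moreover have "{0..r\<^sup>2} \<inter> {x<..} = {x<..r\<^sup>2}" using \<open>\<not> x < 0\<close> by auto
      ultimately show ?thesis using True
        by (simp add: M N ennreal_mult[symmetric] right_diff_distrib)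
    next
      case False
      have "\<not> (x < (norm z)\<^sup>2 \<and> norm z < r)" for z :: complex
        using False power_strict_mono[of "norm z" r 2] by auto
      then have "{z::complex. x < (norm z)\<^sup>2 \<and> norm z < r} = {}" by blast
      moreover have "{0..r\<^sup>2} \<inter> {x<..} = {}" using False by auto
      ultimately show ?thesis by (simp only: M N) simp
    qed
  qed
  show "emeasure ?M {x<..} < \<infinity>"
  proof -
    have "emeasure ?M {x<..} \<le> emeasure lborel (ball 0 r :: complex set)"
      unfolding M by (rule emeasure_mono) auto
    then show ?thesis by (simp add: br le_less_trans)
  qed
qed

text \<open>The integrand is the n-th power of the squared modulus, so the push-forward reduces the
  area integral to that of x^n over [0, r^2].\<close>

lemma nn_integral_norm_power_ball:
  assumes r: "0 < r"
  shows "(\<integral>\<^sup>+z. ennreal (norm z ^ (2 * n)) \<partial>restrict_space lborel (ball (0::complex) r)) =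
    ennreal (pi * r ^ (2 * n + 2) / real (n + 1))"
proof -
  let ?M = "restrict_space lborel (ball (0::complex) r)"
  have [measurable]: "(\<lambda>z::complex. (norm z)\<^sup>2) \<in> borel_measurable ?M"
    by (rule measurable_restrict_space1) simp
  have "(\<integral>\<^sup>+z. ennreal (norm z ^ (2 * n)) \<partial>?M) = (\<integral>\<^sup>+x. ennreal (x ^ n) \<partial>distr ?M borel (\<lambda>z. (norm z)\<^sup>2))"
    by (subst nn_integral_distr) (auto simp: power_mult)
  also have "\<dots> = (\<integral>\<^sup>+x. ennreal pi * (ennreal (x ^ n) * indicator {0..r\<^sup>2} x) \<partial>lborel)"
    by (subst distr_norm_square_ball[OF r], subst nn_integral_density) (auto simp: mult_ac)
  also have "\<dots> = ennreal pi * (\<integral>\<^sup>+x. ennreal (x ^ n) * indicator {0..r\<^sup>2} x \<partial>lborel)"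
    by (rule nn_integral_cmult) simp
  also have "(\<integral>\<^sup>+x. ennreal (x ^ n) * indicator {0..r\<^sup>2} x \<partial>lborel) =
      ennreal ((r\<^sup>2) ^ Suc n / real (Suc n) - 0 ^ Suc n / real (Suc n))"
  proof (rule nn_integral_FTC_Icc)
    fix x assume "x \<in> {0..r\<^sup>2}"
    have "((\<lambda>x. x ^ Suc n / real (Suc n)) has_real_derivative (real (Suc n) * x ^ n) / real (Suc n)) (at x)"
      by (intro DERIV_cdivide) (auto intro!: derivative_eq_intros simp del: power_Suc)
    then show "((\<lambda>x. x ^ Suc n / real (Suc n)) has_real_derivative x ^ n) (at x)"
      by (simp del: of_nat_Suc)
    show "0 \<le> x ^ n" using \<open>x \<in> {0..r\<^sup>2}\<close> by simp
  qed auto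
  also have "ennreal pi * \<dots> = ennreal (pi * r ^ (2 * n + 2) / real (n + 1))"
  proof -
    have "(r\<^sup>2) ^ Suc n = r ^ (2 * n + 2)" by (subst power_mult[symmetric]) simp
    then show ?thesis using r by (simp add: ennreal_mult[symmetric] del: power_Suc)
  qed
  finally show ?thesis .
qed

section \<open>Parseval's formula for area integrals of power series\<close>

lemma finite_measure_lborel_ball: "finite_measure (restrict_space lborel (ball (0::complex) r))"
  by (rule finite_measureI)
    (use emeasure_lborel_ball_finite[of "0::complex" r] in \<open>auto simp: emeasure_restrict_space space_restrict_space\<close>)

lemma integrable_continuous_on_ball:
  fixes f :: "complex \<Rightarrow> complex"
  assumes "continuous_on (cball 0 r) f"
  shows "integrable (restrict_space lborel (ball 0 r)) f"
proof -
  interpret finite_measure "restrict_space lborel (ball (0::complex) r)"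
    by (rule finite_measure_lborel_ball)
  have "compact (f ` cball 0 r)" using assms by (intro compact_continuous_image) auto
  then obtain B where B: "\<And>z. z \<in> cball 0 r \<Longrightarrow> norm (f z) \<le> B"
    by (meson bounded_iff compact_imp_bounded imageI)
  have "f \<in> borel_measurable (restrict_space borel (ball 0 r))"
    by (rule borel_measurable_continuous_on_restrict)
       (use assms in \<open>auto intro: continuous_on_subset\<close>)
  moreover have "AE z in restrict_space lborel (ball 0 r). norm (f z) \<le> B"
    by (rule AE_I2) (use B in \<open>auto simp: space_restrict_space\<close>)
  ultimately show ?thesis
    by (intro integrable_const_bound) (auto cong: measurable_cong_sets sets_restrict_space_cong)
qed

lemma integral_monomial_ball_orthogonal:
  fixes r :: real
  assumes "m \<noteq> n"
  shows "(LINT z|restrict_space lborel (ball 0 r). z ^ m * cnj z ^ n) = (0::complex)"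
proof -
  \<comment> \<open>rotating by \<open>c\<close> changes the sign of the integrand\<close>
  define c where "c = cis (pi / (real m - real n))"
  have c: "norm c = 1" by (simp add: c_def)
  have "c ^ m * cnj c ^ n = cis (real m * (pi / (real m - real n)) - real n * (pi / (real m - real n)))"
    by (simp add: c_def cis_cnj Complex.DeMoivre cis_mult)
  also have "real m * (pi / (real m - real n)) - real n * (pi / (real m - real n)) = pi"
    using assms by (simp add: left_diff_distrib[symmetric] diff_divide_distrib[symmetric])
  finally have cmn: "c ^ m * cnj c ^ n = -1" by simp
  define h where "h = (\<lambda>z::complex. indicator (ball 0 r) z *\<^sub>R (z ^ m * cnj z ^ n))"
  have [measurable]: "h \<in> borel_measurable borel"
    unfolding h_def
    by (intro borel_measurable_scaleR borel_measurable_indicator borel_open open_ball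
          borel_measurable_continuous_onI continuous_intros)
  have "(\<integral>z. h z \<partial>lborel) = (\<integral>z. h z \<partial>distr lborel borel ((*) c))"
    by (simp add: lborel_distr_rotate c)
  also have "\<dots> = (\<integral>z. h (c * z) \<partial>lborel)"
    by (subst integral_distr) auto
  also have "\<dots> = (\<integral>z. - h z \<partial>lborel)"
  proof (rule Bochner_Integration.integral_cong)
    fix z
    have "(c * z) ^ m * cnj (c * z) ^ n = (c ^ m * cnj c ^ n) * (z ^ m * cnj z ^ n)"
      by (simp add: power_mult_distrib)
    then show "h (c * z) = - h z"
      using c by (simp add: h_def cmn indicator_def norm_mult)
  qed simp
  finally have "(\<integral>z. h z \<partial>lborel) = 0" by simp
  then show ?thesis
    by (subst integral_restrict_space) (auto simp: h_def)
qed

lemma integral_monomial_ball_diag: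
  assumes r: "0 < r"
  shows "(LINT z|restrict_space lborel (ball 0 r). z ^ n * cnj z ^ n) = complex_of_real (pi * r ^ (2 * n + 2) / real (n + 1))"
proof -
  let ?M = "restrict_space lborel (ball (0::complex) r)"
  have "(LINT z|?M. z ^ n * cnj z ^ n) = (LINT z|?M. complex_of_real (norm z ^ (2 * n)))"
    by (simp add: power_mult power_mult_distrib[symmetric] complex_norm_square[symmetric])
  also have "\<dots> = complex_of_real (LINT z|?M. norm z ^ (2 * n))"
    by (rule integral_complex_of_real)
  also have "(LINT z|?M. norm z ^ (2 * n)) = pi * r ^ (2 * n + 2) / real (n + 1)"
    using r by (subst integral_eq_nn_integral)
      (auto simp only: nn_integral_norm_power_ball[OF r], auto intro!: measurable_restrict_space1)
  finally show ?thesis .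
qed

text \<open>Writing the squared modulus as P times its conjugate gives a double sum of monomial
  integrals, of which orthogonality leaves only the diagonal.\<close>

lemma nn_integral_polynomial_ball:
  fixes b :: "nat \<Rightarrow> complex"
  assumes r: "0 < r"
  shows "(\<integral>\<^sup>+z. ennreal ((norm (\<Sum>n<N. b n * z ^ n))\<^sup>2) \<partial>restrict_space lborel (ball 0 r)) =
    ennreal (\<Sum>n<N. (norm (b n))\<^sup>2 * (pi * r ^ (2 * n + 2) / real (n + 1)))"
proof -
  let ?M = "restrict_space lborel (ball (0::complex) r)"
  define P where "P = (\<lambda>z::complex. \<Sum>n<N. b n * z ^ n)"
  have int: "integrable ?M (\<lambda>z. z ^ m * cnj z ^ n)" for m n
    by (intro integrable_continuous_on_ball continuous_intros)
  have intP: "integrable ?M (\<lambda>z. complex_of_real ((norm (P z))\<^sup>2))"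
    unfolding P_def by (intro integrable_continuous_on_ball continuous_intros)
  have expand: "complex_of_real ((norm (P z))\<^sup>2) =
      (\<Sum>m<N. \<Sum>n<N. b m * cnj (b n) * (z ^ m * cnj z ^ n))" for z
    by (simp only: complex_norm_square P_def cnj_sum sum_product)
       (simp add: mult_ac)
  have "complex_of_real (LINT z|?M. (norm (P z))\<^sup>2) = (LINT z|?M. complex_of_real ((norm (P z))\<^sup>2))"
    by (rule integral_complex_of_real[symmetric])
  also have "\<dots> = (\<Sum>m<N. \<Sum>n<N. b m * cnj (b n) * (LINT z|?M. z ^ m * cnj z ^ n))"
    by (simp only: expand) (simp add: Bochner_Integration.integral_sum int)
  also have "\<dots> = (\<Sum>m<N. \<Sum>n<N. if m = n then complex_of_real ((norm (b m))\<^sup>2 * (pi * r ^ (2 * m + 2) / real (m + 1))) else 0)"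
    by (intro sum.cong refl) (auto simp: integral_monomial_ball_orthogonal integral_monomial_ball_diag[OF r] complex_norm_square[symmetric])
  also have "\<dots> = complex_of_real (\<Sum>n<N. (norm (b n))\<^sup>2 * (pi * r ^ (2 * n + 2) / real (n + 1)))"
    by (simp add: sum.delta)
  finally have "(LINT z|?M. (norm (P z))\<^sup>2) = (\<Sum>n<N. (norm (b n))\<^sup>2 * (pi * r ^ (2 * n + 2) / real (n + 1)))"
    by (simp only: of_real_eq_iff)
  moreover have "integrable ?M (\<lambda>z. (norm (P z))\<^sup>2)"
    using intP by (simp only: complex_of_real_integrable_eq)
  ultimately show ?thesis
    by (simp add: nn_integral_eq_integral P_def)
qed


text \<open>Passage from partial sums to the series by dominated convergence. A radius below 1 makes
  the partial sums uniformly bounded on the disc, so a constant dominates.\<close>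

lemma nn_integral_power_series_ball:
  fixes b :: "nat \<Rightarrow> complex"
  assumes g: "\<And>z. norm z < 1 \<Longrightarrow> (\<lambda>n. b n * z ^ n) sums g z" and r: "0 < r" "r < 1"
  shows "(\<integral>\<^sup>+z. ennreal ((norm (g z))\<^sup>2) \<partial>restrict_space lborel (ball 0 r)) =
    (\<Sum>n. ennreal ((norm (b n))\<^sup>2 * (pi * r ^ (2 * n + 2) / real (n + 1))))"
proof -
  let ?M = "restrict_space lborel (ball (0::complex) r)"
  define P where "P = (\<lambda>N z. \<Sum>n<N. b n * z ^ n)"
  \<comment> \<open>Convergence at the midpoint of r and 1 gives absolute convergence at the smaller
    modulus r.\<close>
  have "summable (\<lambda>n. norm (b n * complex_of_real r ^ n))"
  proof (rule powser_insidea)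
    show "summable (\<lambda>n. b n * complex_of_real ((1 + r) / 2) ^ n)"
      using g[of "complex_of_real ((1 + r) / 2)"] r by (simp add: sums_iff del: of_real_divide of_real_add)
    show "norm (complex_of_real r) < norm (complex_of_real ((1 + r) / 2))"
      using r by (simp del: of_real_divide of_real_add)
  qed
  then have sm: "summable (\<lambda>n. norm (b n) * r ^ n)"
    using r by (simp add: norm_mult norm_power)
  define B where "B = (\<Sum>n. norm (b n) * r ^ n)"
  have bound: "norm (P N z) \<le> B" if "norm z < r" for N z
  proof -
    have "norm (P N z) \<le> (\<Sum>n<N. norm (b n) * r ^ n)"
      unfolding P_def using that r
      by (intro sum_norm_le) (auto simp: norm_mult norm_power intro!: mult_left_mono power_mono)
    also have "\<dots> \<le> B"
      unfolding B_def using r by (intro sum_le_suminf sm) auto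
    finally show ?thesis .
  qed
  have hol: "g holomorphic_on ball 0 1"
    by (rule power_series_holomorphic[where a = b]) (use g in auto)
  have "continuous_on (ball 0 r) g"
    using holomorphic_on_imp_continuous_on[OF hol] by (rule continuous_on_subset) (use r in auto)
  then have [measurable]: "g \<in> borel_measurable ?M"
    using borel_measurable_continuous_on_restrict[of "ball 0 r" g]
    by (simp cong: measurable_cong_sets sets_restrict_space_cong)
  have [measurable]: "P N \<in> borel_measurable ?M" for N
    unfolding P_def
    by (intro measurable_restrict_space1) (auto intro!: borel_measurable_continuous_onI continuous_intros)
  have "(\<lambda>N. \<integral>\<^sup>+z. ennreal ((norm (P N z))\<^sup>2) \<partial>?M) \<longlonglongrightarrow> (\<integral>\<^sup>+z. ennreal ((norm (g z))\<^sup>2) \<partial>?M)"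
  proof (rule nn_integral_dominated_convergence[where w = "\<lambda>_. ennreal (B\<^sup>2)"])
    show "AE z in ?M. ennreal ((norm (P N z))\<^sup>2) \<le> ennreal (B\<^sup>2)" for N
      by (rule AE_I2) (use bound in \<open>auto simp: space_restrict_space intro!: ennreal_leI power_mono\<close>)
    show "(\<integral>\<^sup>+z. ennreal (B\<^sup>2) \<partial>?M) < \<infinity>"
      using finite_measure.emeasure_finite[OF finite_measure_lborel_ball[of r], of "space ?M"]
      by (simp add: ennreal_mult_less_top less_top)
    show "AE z in ?M. (\<lambda>N. ennreal ((norm (P N z))\<^sup>2)) \<longlonglongrightarrow> ennreal ((norm (g z))\<^sup>2)"
    proof (rule AE_I2)
      fix z assume "z \<in> space ?M"
      then have "norm z < 1" using r by (simp add: space_restrict_space)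
      then show "(\<lambda>N. ennreal ((norm (P N z))\<^sup>2)) \<longlonglongrightarrow> ennreal ((norm (g z))\<^sup>2)"
        using g[of z] unfolding sums_def P_def by (intro tendsto_intros)
    qed
  qed auto
  moreover have "(\<lambda>N. \<integral>\<^sup>+z. ennreal ((norm (P N z))\<^sup>2) \<partial>?M) \<longlonglongrightarrow>
      (\<Sum>n. ennreal ((norm (b n))\<^sup>2 * (pi * r ^ (2 * n + 2) / real (n + 1))))"
    unfolding P_def nn_integral_polynomial_ball[OF r(1)]
  proof (subst sum_ennreal[symmetric])
    show "0 \<le> (norm (b n))\<^sup>2 * (pi * r ^ (2 * n + 2) / real (n + 1))" for n
      using r by simp
  qed (rule summable_LIMSEQ, rule summableI)
  ultimately show ?thesis by (rule LIMSEQ_unique)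
qed

text \<open>The disc is exhausted by radii increasing to 1, and both the integrals and the series
  increase along them. Monotone convergence therefore applies on both sides, and the identity also
  covers the case where both are infinite.\<close>

lemma nn_integral_power_series_disc:
  fixes b :: "nat \<Rightarrow> complex"
  assumes g: "\<And>z. norm z < 1 \<Longrightarrow> (\<lambda>n. b n * z ^ n) sums g z"
  shows "(\<integral>\<^sup>+z. ennreal ((norm (g z))\<^sup>2) \<partial>disc_area) =
    (\<Sum>n. ennreal ((norm (b n))\<^sup>2 / real (n + 1)))"
proof -
  define r where "r = (\<lambda>k. real (k + 1) / real (k + 2))"
  have r: "0 < r k" "r k < 1" for k by (auto simp: r_def)
  have r_lim: "r \<longlonglongrightarrow> 1" unfolding r_def by real_asymp
  have r_inc: "incseq r"
    by (rule incseq_SucI) (simp add: r_def field_simps)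
  have term_inc: "incseq (\<lambda>k. ennreal ((norm (b n))\<^sup>2 * (pi * r k ^ (2 * n + 2) / real (n + 1))))" for n
  proof (rule incseq_SucI, rule ennreal_leI)
    fix k
    have "r k ^ (2 * n + 2) \<le> r (Suc k) ^ (2 * n + 2)"
      by (rule power_mono) (use r_inc r[of k] in \<open>auto simp: incseq_def\<close>)
    then show "(norm (b n))\<^sup>2 * (pi * r k ^ (2 * n + 2) / real (n + 1)) \<le>
        (norm (b n))\<^sup>2 * (pi * r (Suc k) ^ (2 * n + 2) / real (n + 1))"
      by (intro mult_left_mono divide_right_mono) auto
  qed
  have hol: "g holomorphic_on ball 0 1"
    by (rule power_series_holomorphic[where a = b]) (use g in auto)
  \<comment> \<open>Nothing is known about \<open>g\<close> outside the disc; extension by zero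
    makes it Borel on the whole plane.\<close>
  define G where "G = (\<lambda>z. indicator unit_disc z *\<^sub>R g z)"
  have [measurable]: "G \<in> borel_measurable borel"
    unfolding G_def
    by (intro borel_measurable_continuous_on_indicator holomorphic_on_imp_continuous_on hol) auto
  define h where "h = (\<lambda>k z. ennreal ((norm (G z))\<^sup>2) * indicator (ball 0 (r k)) z)"
  have h_inc: "incseq h"
    using r_inc by (auto simp: incseq_def le_fun_def h_def indicator_def intro: less_le_trans)
  have [measurable]: "h k \<in> borel_measurable lborel" for k
    unfolding h_def
    by (intro borel_measurable_times_ennreal borel_measurable_indicator) (simp_all add: borel_open)
  have h_lim: "(\<lambda>k. h k z) \<longlonglongrightarrow> ennreal ((norm (g z))\<^sup>2) * indicator unit_disc z" for z
  proof (cases "norm z < 1")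
    case True
    have "eventually (\<lambda>k. norm z < r k) sequentially"
      using r_lim True by (rule order_tendstoD)
    then have "eventually (\<lambda>k. h k z = ennreal ((norm (g z))\<^sup>2) * indicator unit_disc z) sequentially"
      by eventually_elim (use True in \<open>auto simp: h_def G_def\<close>)
    then show ?thesis by (rule tendsto_eventually)
  next
    case False
    then have "h k z = 0" for k by (simp add: h_def G_def)
    then show ?thesis using False by simp
  qed
  have h_int: "integral\<^sup>N lborel (h k) = (\<Sum>n. ennreal ((norm (b n))\<^sup>2 * (pi * r k ^ (2 * n + 2) / real (n + 1))))" for k
  proof -
    have "integral\<^sup>N lborel (h k) = (\<integral>\<^sup>+z. ennreal ((norm (g z))\<^sup>2) * indicator (ball 0 (r k)) z \<partial>lborel)"
      by (rule nn_integral_cong) (use r[of k] in \<open>auto simp: h_def G_def indicator_def\<close>)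
    also have "\<dots> = (\<integral>\<^sup>+z. ennreal ((norm (g z))\<^sup>2) \<partial>restrict_space lborel (ball 0 (r k)))"
      by (rule nn_integral_restrict_space[symmetric]) auto
    finally show ?thesis
      by (simp add: nn_integral_power_series_ball[OF g r])
  qed
  have "(\<integral>\<^sup>+z. ennreal ((norm (g z))\<^sup>2) \<partial>restrict_space lborel unit_disc) =
      (\<integral>\<^sup>+z. ennreal ((norm (g z))\<^sup>2) * indicator unit_disc z \<partial>lborel)"
    by (rule nn_integral_restrict_space) auto
  also have "\<dots> = (SUP k. integral\<^sup>N lborel (h k))"
  proof -
    have "(SUP k. h k z) = ennreal ((norm (g z))\<^sup>2) * indicator unit_disc z" for z
      using LIMSEQ_SUP[of "\<lambda>k. h k z"] h_lim[of z] h_inc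
      by (intro LIMSEQ_unique[of "\<lambda>k. h k z"]) (auto simp: incseq_def le_fun_def)
    then show ?thesis
      using nn_integral_monotone_convergence_SUP[OF h_inc, of lborel] by simp
  qed
  also have "\<dots> = (SUP k. \<Sum>n. ennreal ((norm (b n))\<^sup>2 * (pi * r k ^ (2 * n + 2) / real (n + 1))))"
    by (simp only: h_int)
  \<comment> \<open>Supremum and series may be exchanged because each term increases with
    \<open>k\<close>.\<close>
  also have "\<dots> = (\<Sum>n. SUP k. ennreal ((norm (b n))\<^sup>2 * (pi * r k ^ (2 * n + 2) / real (n + 1))))"
  proof (rule ennreal_suminf_SUP_eq[symmetric])
    fix n
    show "incseq (\<lambda>k. ennreal ((norm (b n))\<^sup>2 * (pi * r k ^ (2 * n + 2) / real (n + 1))))"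
      by (rule term_inc)
  qed
  also have "\<dots> = (\<Sum>n. ennreal ((norm (b n))\<^sup>2 * (pi * 1 ^ (2 * n + 2) / real (n + 1))))"
  proof (rule suminf_cong)
    fix n
    let ?f = "\<lambda>k. ennreal ((norm (b n))\<^sup>2 * (pi * r k ^ (2 * n + 2) / real (n + 1)))"
    have "incseq ?f" by (rule term_inc)
    then have "?f \<longlonglongrightarrow> (SUP k. ?f k)" by (rule LIMSEQ_SUP)
    moreover have "?f \<longlonglongrightarrow> ennreal ((norm (b n))\<^sup>2 * (pi * 1 ^ (2 * n + 2) / real (n + 1)))"
      by (intro tendsto_intros r_lim) auto
    ultimately show "(SUP k. ?f k) = ennreal ((norm (b n))\<^sup>2 * (pi * 1 ^ (2 * n + 2) / real (n + 1)))"
      by (rule LIMSEQ_unique)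
  qed
  finally have *: "(\<integral>\<^sup>+z. ennreal ((norm (g z))\<^sup>2) \<partial>restrict_space lborel unit_disc) = \<dots>" .
  have [measurable]: "g \<in> borel_measurable (restrict_space lborel unit_disc)"
    using borel_measurable_continuous_on_restrict[OF holomorphic_on_imp_continuous_on[OF hol]]
    by (simp cong: measurable_cong_sets sets_restrict_space_cong)
  have "(\<integral>\<^sup>+z. ennreal ((norm (g z))\<^sup>2) \<partial>disc_area) = ennreal (1 / pi) *
      (\<Sum>n. ennreal ((norm (b n))\<^sup>2 * (pi * 1 ^ (2 * n + 2) / real (n + 1))))"
    unfolding disc_area_def * [symmetric] by (rule nn_integral_scale_measure) simp
  also have "\<dots> = (\<Sum>n. ennreal (1 / pi) * ennreal ((norm (b n))\<^sup>2 * (pi * 1 ^ (2 * n + 2) / real (n + 1))))"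
    by (rule ennreal_suminf_cmult[symmetric])
  also have "\<dots> = (\<Sum>n. ennreal ((norm (b n))\<^sup>2 / real (n + 1)))"
    by (rule suminf_cong) (simp add: ennreal_mult[symmetric])
  finally show ?thesis .
qed

section \<open>The Dirichlet norm in terms of Taylor coefficients\<close>

text \<open>Lets coefficients be read off from an explicit series, both for the kernels and for the
  image of the Cesaro operator.\<close>

lemma power_series_coeffs:
  assumes f: "\<And>z. norm z < 1 \<Longrightarrow> (\<lambda>n. a n * z ^ n) sums f z"
  shows "f holomorphic_on unit_disc" "fps_nth (fps_expansion f 0) n = a n"
proof -
  show hol: "f holomorphic_on unit_disc"
    by (rule power_series_holomorphic[where a = a]) (use f in auto)
  have "conv_radius a \<ge> 1"
  proof (rule conv_radius_geI_ex)
    fix r :: real assume "0 < r" "ereal r < 1"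
    then show "\<exists>z. norm z = r \<and> summable (\<lambda>n. a n * z ^ n)"
      using f[of "complex_of_real r"] by (intro exI[of _ "complex_of_real r"]) (simp add: sums_iff)
  qed
  then have "f has_fps_expansion (Abs_fps a)"
    unfolding has_fps_expansion_def fps_conv_radius_def
  proof (intro conjI)
    show "eventually (\<lambda>z. eval_fps (Abs_fps a) z = f z) (nhds 0)"
      using eventually_nhds_in_open[of unit_disc 0]
    proof (rule eventually_mono)
      fix z assume "z \<in> unit_disc"
      then show "eval_fps (Abs_fps a) z = f z"
        using f[of z] by (simp add: eval_fps_def sums_iff)
    qed auto
    show "0 < conv_radius (fps_nth (Abs_fps a))"
      using \<open>conv_radius a \<ge> 1\<close> by (simp add: less_le_trans[of 0 1])
  qed
  then have "fps_expansion f 0 = Abs_fps a"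
    by (rule fps_expansion_eqI)
  then show "fps_nth (fps_expansion f 0) n = a n"
    by simp
qed

text \<open>The derivative has coefficients (n + 1) a_(n+1); squaring them and dividing by n + 1 as
  in Parseval's formula leaves one factor n + 1. The index shift back costs nothing, since the term
  with n = 0 vanishes.\<close>

lemma dirichlet_sqnorm_coeffs:
  assumes hol: "f holomorphic_on unit_disc"
  defines "a \<equiv> fps_nth (fps_expansion f 0)"
  shows "dirichlet_sqnorm f = ennreal ((norm (a 0))\<^sup>2) + (\<Sum>n. ennreal (real n * (norm (a n))\<^sup>2))"
proof -
  have d: "deriv f holomorphic_on unit_disc"
    by (rule holomorphic_deriv[OF hol]) auto
  have an: "a n = (deriv ^^ n) f 0 / fact n" for n
    by (simp add: a_def fps_expansion_def)
  have "(\<lambda>n. (of_nat (Suc n) * a (Suc n)) * z ^ n) sums deriv f z" if "norm z < 1" for z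
  proof -
    have "(\<lambda>n. (deriv ^^ n) (deriv f) 0 / fact n * (z - 0) ^ n) sums deriv f z"
      by (rule holomorphic_power_series[OF d]) (use that in auto)
    moreover have "(deriv ^^ n) (deriv f) 0 / fact n = of_nat (Suc n) * a (Suc n)" for n
      by (simp add: an funpow_swap1 divide_simps del: of_nat_Suc)
    ultimately show ?thesis by simp
  qed
  from nn_integral_power_series_disc[OF this]
  have "(\<integral>\<^sup>+z. ennreal ((norm (deriv f z))\<^sup>2) \<partial>disc_area) =
      (\<Sum>n. ennreal ((norm (of_nat (Suc n) * a (Suc n)))\<^sup>2 / real (n + 1)))" .
  also have "\<dots> = (\<Sum>n. ennreal (real (Suc n) * (norm (a (Suc n)))\<^sup>2))"
    by (rule suminf_cong) (simp add: norm_mult power_mult_distrib power2_eq_square del: of_nat_Suc)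
  also have "\<dots> = (\<Sum>n. ennreal (real n * (norm (a n))\<^sup>2))"
    by (subst suminf_offset[of "\<lambda>n. ennreal (real n * (norm (a n))\<^sup>2)" 1]) (simp_all add: summableI)
  finally show ?thesis
    by (simp add: dirichlet_sqnorm_def an[of 0])
qed

lemma dirichlet_space_iff:
  "f \<in> dirichlet_space \<longleftrightarrow> f holomorphic_on unit_disc \<and>
    summable (\<lambda>n. real n * (norm (fps_nth (fps_expansion f 0) n))\<^sup>2)"
proof -
  have "(\<Sum>n. ennreal (u n)) < \<infinity> \<longleftrightarrow> summable u" if "\<And>n. 0 \<le> u n" for u :: "nat \<Rightarrow> real"
    using summable_suminf_not_top[of u, OF that] ennreal_suminf_neq_top[of u, OF _ that]
    by (metis infinity_ennreal_def less_top)
  then have "(\<Sum>n. ennreal (real n * (norm (fps_nth (fps_expansion f 0) n))\<^sup>2)) < \<infinity> \<longleftrightarrow>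
      summable (\<lambda>n. real n * (norm (fps_nth (fps_expansion f 0) n))\<^sup>2)"
    by simp
  then show ?thesis
    unfolding dirichlet_space_def mem_Collect_eq
    by (intro conj_cong refl) (simp add: dirichlet_sqnorm_coeffs)
qed

text \<open>The value 1 at 0 absorbs the summand |f(0)|^2, so the squared norm becomes a single
  weighted sum. It also keeps the weight positive, so that its reciprocals make sense.\<close>

definition dirichlet_weight :: "nat \<Rightarrow> real" where
  "dirichlet_weight n = (if n = 0 then 1 else real n)"

lemma dirichlet_weight_pos: "0 < dirichlet_weight n"
  by (simp add: dirichlet_weight_def)

text \<open>On the Dirichlet space the extended squared norm is finite, so \<open>enn2real\<close>
  loses nothing and the coefficient formula becomes one between reals.\<close>

lemma dirichlet_norm_sums:
  assumes "f \<in> dirichlet_space"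
  shows "(\<lambda>n. dirichlet_weight n * (norm (fps_nth (fps_expansion f 0) n))\<^sup>2) sums (dirichlet_norm f)\<^sup>2"
proof -
  define a where "a = fps_nth (fps_expansion f 0)"
  have hol: "f holomorphic_on unit_disc" and sm: "summable (\<lambda>n. real n * (norm (a n))\<^sup>2)"
    using assms by (auto simp: dirichlet_space_iff a_def)
  have "(\<Sum>n. ennreal (real n * (norm (a n))\<^sup>2)) = ennreal (\<Sum>n. real n * (norm (a n))\<^sup>2)"
    by (rule suminf_ennreal2) (use sm in auto)
  then have "dirichlet_sqnorm f = ennreal ((norm (a 0))\<^sup>2 + (\<Sum>n. real n * (norm (a n))\<^sup>2))"
    using suminf_nonneg[OF sm] by (simp add: dirichlet_sqnorm_coeffs[OF hol] a_def flip: ennreal_plus)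
  then have "(dirichlet_norm f)\<^sup>2 = (norm (a 0))\<^sup>2 + (\<Sum>n. real n * (norm (a n))\<^sup>2)"
    using suminf_nonneg[OF sm] by (simp add: dirichlet_norm_def del: ennreal_plus)
  moreover have "(\<lambda>n. (if n = 0 then (norm (a 0))\<^sup>2 else 0) + real n * (norm (a n))\<^sup>2) sums
      ((norm (a 0))\<^sup>2 + (\<Sum>n. real n * (norm (a n))\<^sup>2))"
    using sums_single[of 0 "\<lambda>_. (norm (a 0))\<^sup>2"] summable_sums[OF sm] by (intro sums_add) auto
  moreover have "(if n = 0 then (norm (a 0))\<^sup>2 else 0) + real n * (norm (a n))\<^sup>2 = dirichlet_weight n * (norm (a n))\<^sup>2" for n
    by (simp add: dirichlet_weight_def)
  ultimately show ?thesis by (simp add: a_def)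
qed



section \<open>Reproducing kernels at points of [0, 1)\<close>

lemma dirichlet_kernel_sums:
  assumes t: "0 \<le> t" "t < 1" and z: "norm z < 1"
  shows "(\<lambda>n. complex_of_real (t ^ n / dirichlet_weight n) * z ^ n) sums dirichlet_kernel (complex_of_real t) z"
proof -
  have "norm z * t < 1"
    using t z by (meson less_eq_real_def mult_le_one mult_right_le_one_le norm_ge_zero order_le_less_trans)
  then have tz: "norm (z * complex_of_real t) < 1"
    using t by (simp add: norm_mult)
  \<comment> \<open>Positive real part keeps the argument off the branch cut, so the logarithm of
    the reciprocal is the negated logarithm.\<close>
  have re: "Re (1 - z * complex_of_real t) > 0"
    using tz complex_Re_le_cmod[of "z * complex_of_real t"] by simp
  then have "Ln (1 / (1 - z * complex_of_real t)) = - Ln (1 - z * complex_of_real t)"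
    using Ln_inverse[of "1 - z * complex_of_real t"]
    by (auto simp: inverse_eq_divide complex_nonpos_Reals_iff)
  then have K: "dirichlet_kernel (complex_of_real t) z = 1 + - Ln (1 - z * complex_of_real t)"
    by (simp add: dirichlet_kernel_def)
  have "(\<lambda>n. - ((z * complex_of_real t) ^ n) / of_nat n) sums Ln (1 - z * complex_of_real t)"
    using Ln_series'[of "- (z * complex_of_real t)"] tz by simp
  then have "(\<lambda>n. (z * complex_of_real t) ^ n / of_nat n) sums (- Ln (1 - z * complex_of_real t))"
    using sums_minus by fastforce
  \<comment> \<open>Division by zero yields 0, so the logarithmic series has term 0 at n = 0; the
    constant 1 of the kernel fills exactly this slot, where \<open>dirichlet_weight\<close> is
    1.\<close>
  from sums_add[OF sums_single[of 0 "\<lambda>_. 1"] this]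
  have "(\<lambda>n. (if n = 0 then 1 else 0) + (z * complex_of_real t) ^ n / of_nat n) sums
      dirichlet_kernel (complex_of_real t) z"
    unfolding K .
  moreover have "(if n = 0 then 1 else 0) + (z * complex_of_real t) ^ n / of_nat n =
      complex_of_real (t ^ n / dirichlet_weight n) * z ^ n" for n
    by (simp add: dirichlet_weight_def power_mult_distrib)
  ultimately show ?thesis by simp
qed

lemma dirichlet_kernel_diag:
  assumes t: "0 \<le> t" "t < 1"
  shows "Re (dirichlet_kernel (complex_of_real t) (complex_of_real t)) = 1 - ln (1 - t\<^sup>2)"
proof -
  have t2: "t\<^sup>2 < 1" using t by (simp add: power_less_one_iff abs_square_less_1)
  have eq: "1 / (1 - complex_of_real t * cnj (complex_of_real t)) = complex_of_real (1 / (1 - t\<^sup>2))"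
    by (simp add: power2_eq_square)
  have "0 < 1 / (1 - t\<^sup>2)" using t2 by simp
  then have "Ln (1 / (1 - complex_of_real t * cnj (complex_of_real t))) = complex_of_real (ln (1 / (1 - t\<^sup>2)))"
    unfolding eq by (rule Ln_of_real)
  then show ?thesis
    using t2 by (simp add: dirichlet_kernel_def ln_div)
qed

text \<open>The kernel series evaluated at z = t. The left side is the coefficient form of the
  squared norm of the kernel, so this is the identity K_t(t) = ||K_t||^2 behind the
  normalization.\<close>

lemma dirichlet_kernel_diag_sums:
  assumes t: "0 \<le> t" "t < 1"
  shows "(\<lambda>n. dirichlet_weight n * (t ^ n / dirichlet_weight n)\<^sup>2) sums
    Re (dirichlet_kernel (complex_of_real t) (complex_of_real t))"
proof -
  have "Re (complex_of_real (t ^ n / dirichlet_weight n) * complex_of_real t ^ n) =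
      dirichlet_weight n * (t ^ n / dirichlet_weight n)\<^sup>2" for n
    using dirichlet_weight_pos[of n] by (simp add: power2_eq_square flip: of_real_power)
  then show ?thesis
    using sums_Re[OF dirichlet_kernel_sums[OF t, of "complex_of_real t"]] t by simp
qed

lemma dirichlet_kernel_diag_pos:
  assumes t: "0 \<le> t" "t < 1"
  shows "0 < Re (dirichlet_kernel (complex_of_real t) (complex_of_real t))"
proof -
  have "0 < 1 - t\<^sup>2" "1 - t\<^sup>2 \<le> 1"
    using t by (simp_all add: power_less_one_iff abs_square_less_1)
  then have "ln (1 - t\<^sup>2) \<le> 0" by simp
  then show ?thesis by (simp add: dirichlet_kernel_diag[OF t])
qed

lemma normalized_dirichlet_kernel_coeffs:
  assumes t: "0 \<le> t" "t < 1"
  shows "normalized_dirichlet_kernel (complex_of_real t) holomorphic_on unit_disc"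
    "fps_nth (fps_expansion (normalized_dirichlet_kernel (complex_of_real t)) 0) n =
      complex_of_real (t ^ n / dirichlet_weight n /
        sqrt (Re (dirichlet_kernel (complex_of_real t) (complex_of_real t))))"
proof -
  let ?k = "normalized_dirichlet_kernel (complex_of_real t)"
  let ?a = "\<lambda>n. complex_of_real (t ^ n / dirichlet_weight n /
    sqrt (Re (dirichlet_kernel (complex_of_real t) (complex_of_real t))))"
  have *: "(\<lambda>n. ?a n * z ^ n) sums ?k z" if "norm z < 1" for z
    using sums_divide[OF dirichlet_kernel_sums[OF t that],
        of "complex_of_real (sqrt (Re (dirichlet_kernel (complex_of_real t) (complex_of_real t))))"]
    by (simp add: normalized_dirichlet_kernel_def)
  show "?k holomorphic_on unit_disc"
    by (rule power_series_coeffs(1)[of ?a, OF *])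
  show "fps_nth (fps_expansion ?k 0) n = ?a n"
    by (rule power_series_coeffs(2)[of ?a, OF *])
qed

lemma normalized_dirichlet_kernel_norm:
  assumes t: "0 \<le> t" "t < 1"
  shows "normalized_dirichlet_kernel (complex_of_real t) \<in> dirichlet_space"
    "dirichlet_norm (normalized_dirichlet_kernel (complex_of_real t)) = 1"
proof -
  let ?k = "normalized_dirichlet_kernel (complex_of_real t)"
  let ?K = "Re (dirichlet_kernel (complex_of_real t) (complex_of_real t))"
  note pos = dirichlet_kernel_diag_pos[OF t]
  have eq: "(norm (fps_nth (fps_expansion ?k 0) n))\<^sup>2 = (t ^ n / dirichlet_weight n)\<^sup>2 / ?K" for n
    unfolding normalized_dirichlet_kernel_coeffs[OF t] norm_of_real using pos
    by (simp add: power_divide power_mult_distrib)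
  have s: "(\<lambda>n. dirichlet_weight n * (norm (fps_nth (fps_expansion ?k 0) n))\<^sup>2) sums 1"
    using sums_divide[OF dirichlet_kernel_diag_sums[OF t], of ?K] pos by (simp add: eq)
  have "summable (\<lambda>n. real n * (norm (fps_nth (fps_expansion ?k 0) n))\<^sup>2)"
    by (rule summable_comparison_test'[OF sums_summable[OF s], of 0])
      (simp add: dirichlet_weight_def mult_right_mono)
  then show D: "?k \<in> dirichlet_space"
    by (simp add: dirichlet_space_iff normalized_dirichlet_kernel_coeffs(1)[OF t])
  have "(dirichlet_norm ?k)\<^sup>2 = 1"
    using dirichlet_norm_sums[OF D] s by (rule sums_unique2)
  then show "dirichlet_norm ?k = 1"
    by (auto simp: power2_eq_1_iff dirichlet_norm_def)
qed

section \<open>Taylor coefficients of the Cesaro image\<close>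

lemma cesaro_coeffs:
  assumes "cesaro_well_defined \<eta> f"
  shows "fps_nth (fps_expansion (cesaro \<eta> f) 0) n = cesaro_coeff \<eta> f n"
  by (rule power_series_coeffs(2))
    (use assms in \<open>auto simp: cesaro_well_defined_def cesaro_def\<close>)

text \<open>Bounded coefficients are dominated by a geometric series at every point of the
  disc.\<close>

lemma cesaro_well_defined_of_bounded:
  assumes "\<And>n. norm (cesaro_coeff \<eta> f n) \<le> B"
  shows "cesaro_well_defined \<eta> f"
proof -
  have sm: "summable (\<lambda>n. cesaro_coeff \<eta> f n * z ^ n)" if z: "norm z < 1" for z
  proof (rule summable_comparison_test'[of "\<lambda>n. B * norm z ^ n" 0])
    show "summable (\<lambda>n. B * norm z ^ n)"
      using z by (intro summable_mult summable_geometric) simp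
    show "norm (cesaro_coeff \<eta> f n * z ^ n) \<le> B * norm z ^ n" for n
      using assms by (simp add: norm_mult norm_power mult_right_mono)
  qed
  moreover have "cesaro \<eta> f holomorphic_on unit_disc"
    by (rule power_series_coeffs(1)[of "cesaro_coeff \<eta> f"])
      (use sm in \<open>auto simp: cesaro_def\<close>)
  ultimately show ?thesis by (simp add: cesaro_well_defined_def)
qed

section \<open>Logarithmic size of the weight sums and of the test kernels\<close>

text \<open>One plus the n-th harmonic number; this is the second factor in the Muckenhoupt
  condition.\<close>

definition weight_sum :: "nat \<Rightarrow> real" where
  "weight_sum n = (\<Sum>k\<le>n. 1 / dirichlet_weight k)"

text \<open>Both are ln u \<le> u - 1, at u = x / y and at u = y / x.\<close>

lemma ln_diff_bounds:
  fixes x y :: real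
  assumes "0 < x" "x \<le> y"
  shows "(y - x) / y \<le> ln y - ln x" "ln y - ln x \<le> (y - x) / x"
  using ln_le_minus_one[of "x / y"] ln_le_minus_one[of "y / x"] assms
  by (simp_all add: ln_div diff_divide_distrib)

text \<open>By induction, comparing the increment 1 / (n + 1) with ln (n + 3) - ln (n + 2), which
  lies between 1 / (n + 3) and 1 / (n + 2). The factor 5 suffices because n + 3 \<le> 5 (n + 1) and
  ln 2 \<ge> 1 / 2.\<close>

lemma weight_sum_bounds: "ln (real n + 2) \<le> weight_sum n" "weight_sum n \<le> 5 * ln (real n + 2)"
proof (induction n)
  case 0
  {
    case 1
    show ?case using ln_diff_bounds(2)[of 1 2] by (simp add: weight_sum_def dirichlet_weight_def)
  next
    case 2
    show ?case using ln_diff_bounds(1)[of 1 2] by (simp add: weight_sum_def dirichlet_weight_def)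
  }
next
  case (Suc n)
  have V: "weight_sum (Suc n) = weight_sum n + 1 / (real n + 1)"
    by (simp add: weight_sum_def dirichlet_weight_def add.commute)
  have s: "real (Suc n) + 2 = real n + 3" by simp
  {
    case 1
    have "ln (real n + 3) - ln (real n + 2) \<le> 1 / (real n + 2)"
      using ln_diff_bounds(2)[of "real n + 2" "real n + 3"] by simp
    also have "\<dots> \<le> 1 / (real n + 1)" by (simp add: frac_le)
    finally show ?case using Suc.IH(1) unfolding V s by linarith
  next
    case 2
    have "1 / (real n + 1) \<le> 5 * (1 / (real n + 3))" by (simp add: field_simps)
    moreover have "1 / (real n + 3) \<le> ln (real n + 3) - ln (real n + 2)"
      using ln_diff_bounds(1)[of "real n + 2" "real n + 3"] by simp
    ultimately show ?case using Suc.IH(2) unfolding V s by linarith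
  }
qed

text \<open>Since 1 / t = 1 + 1 / (m + 1) is at most exp (1 / (m + 1)), the powers of t up to the
  m-th stay above 1 / e. The first m + 1 terms are thus at least those of \<open>weight_sum\<close>
  divided by e, and later terms are nonnegative.\<close>

lemma kernel_partial_sum_ge:
  fixes m n :: nat
  defines "t \<equiv> real (m + 1) / real (m + 2)"
  assumes "m \<le> n"
  shows "exp (-1) * ln (real m + 2) \<le> (\<Sum>k\<le>n. t ^ k / dirichlet_weight k)"
proof -
  have t: "0 < t" "t \<le> 1" by (simp_all add: t_def)
  have "exp (-1) \<le> t ^ m"
  proof -
    have "(1 / t) ^ m \<le> exp 1"
    proof -
      have "1 / t = 1 + 1 / (real m + 1)" by (simp add: t_def field_simps)
      also have "\<dots> \<le> exp (1 / (real m + 1))" by simp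
      finally have "(1 / t) ^ m \<le> exp (1 / (real m + 1)) ^ m"
        using t by (intro power_mono) auto
      also have "\<dots> = exp (real m / (real m + 1))" by (simp flip: exp_of_nat_mult)
      also have "\<dots> \<le> exp 1" by simp
      finally show ?thesis .
    qed
    then show ?thesis using t by (simp add: power_divide exp_minus field_simps)
  qed
  moreover have "t ^ m \<le> t ^ k" if "k \<le> m" for k
    using that t by (intro power_decreasing) auto
  ultimately have e: "exp (-1) \<le> t ^ k" if "k \<le> m" for k
    using that by (meson order_trans)
  have "exp (-1) * ln (real m + 2) \<le> exp (-1) * weight_sum m"
    by (intro mult_left_mono weight_sum_bounds) auto
  also have "\<dots> = (\<Sum>k\<le>m. exp (-1) / dirichlet_weight k)"
    by (simp add: weight_sum_def sum_distrib_left)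
  also have "\<dots> \<le> (\<Sum>k\<le>m. t ^ k / dirichlet_weight k)"
    by (intro sum_mono divide_right_mono) (auto simp: e dirichlet_weight_pos less_imp_le)
  also have "\<dots> \<le> (\<Sum>k\<le>n. t ^ k / dirichlet_weight k)"
    using assms t dirichlet_weight_pos by (intro sum_mono2) (auto simp: less_imp_le)
  finally show ?thesis .
qed

text \<open>Here 1 - t^2 \<ge> 1 - t = 1 / (m + 2), so the logarithm in the kernel contributes at
  most ln (m + 2). The summand 1 is at most twice that, as ln 2 \<ge> 1 / 2; hence the factor
  3.\<close>

lemma dirichlet_kernel_diag_le:
  fixes m :: nat
  defines "t \<equiv> real (m + 1) / real (m + 2)"
  shows "Re (dirichlet_kernel (complex_of_real t) (complex_of_real t)) \<le> 3 * ln (real m + 2)"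
proof -
  have t: "0 \<le> t" "t < 1" by (simp_all add: t_def)
  have "1 / (real m + 2) = 1 - t" by (simp add: t_def field_simps)
  also have "\<dots> \<le> 1 - t\<^sup>2" using t by (simp add: power2_eq_square mult_left_le)
  finally have "ln (1 / (real m + 2)) \<le> ln (1 - t\<^sup>2)"
    using t by (subst ln_le_cancel_iff) (simp_all add: power_less_one_iff abs_square_less_1)
  then have "- ln (1 - t\<^sup>2) \<le> ln (real m + 2)" by (simp add: ln_div)
  moreover have "1 / 2 \<le> ln (2::real)" using ln_diff_bounds(1)[of 1 2] by simp
  then have "1 / 2 \<le> ln (real m + 2)" by (rule order_trans) simp
  ultimately show ?thesis by (simp add: dirichlet_kernel_diag[OF t])
qed


section \<open>The weighted discrete Hardy inequality\<close>

text \<open>Sufficiency of Muckenhoupt's condition. \<open>W\<close> plays the tail of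
  \<open>w\<close>, given by its recurrence so that the argument stays within finite sums. Each of
  the two telescoping estimates costs a factor 2, which gives the 4.\<close>

lemma weighted_hardy_inequality:
  fixes v w W x :: "nat \<Rightarrow> real"
  assumes v: "\<And>k. 0 < v k" and w: "\<And>n. 0 \<le> w n"
    and W: "\<And>n. 0 \<le> W n" "\<And>n. W n = w n + W (Suc n)"
    and C: "\<And>n. W n * (\<Sum>k\<le>n. 1 / v k) \<le> C"
  shows "(\<Sum>n<N. w n * (\<Sum>k\<le>n. x k)\<^sup>2) \<le> 4 * C * (\<Sum>k<N. v k * (x k)\<^sup>2)"
proof -
  define V where "V = (\<lambda>n. \<Sum>k\<le>n. 1 / v k)"
  \<comment> \<open>Cauchy-Schwarz with the extra weight \<open>sqrt (V k)\<close>; the sums it produces then telescope\<close>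
  define y where "y = (\<lambda>k. v k * sqrt (V k) * (x k)\<^sup>2)"
  have V_pos: "0 < V n" for n
    unfolding V_def using v by (intro sum_pos) auto
  have y_nonneg: "0 \<le> y k" for k
    using v[of k] V_pos[of k] by (simp add: y_def)
  have VC: "sqrt (W n) * sqrt (V n) \<le> sqrt C" for n
    using C[of n] by (simp add: V_def real_sqrt_mult[symmetric])
  have C0: "0 \<le> C"
    using C[of 0] W(1)[of 0] v[of 0] by (meson divide_nonneg_pos mult_nonneg_nonneg order_trans sum_nonneg v zero_le_one)
  \<comment> \<open>Discrete form of the integral of dV / sqrt V. The increment 1 / v of V factors
    as (p - q) (p + q) with p + q \<le> 2 p, so each term is at most twice an increment of sqrt
    V.\<close>
  have inv_sum: "(\<Sum>k\<le>n. 1 / (v k * sqrt (V k))) \<le> 2 * sqrt (V n)" for n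
  proof (induction n)
    case 0
    have "1 / (v 0 * sqrt (V 0)) = V 0 / sqrt (V 0)" by (simp add: V_def)
    also have "\<dots> = sqrt (V 0)" using V_pos[of 0] by (simp add: real_div_sqrt)
    finally show ?case using V_pos[of 0] by simp
  next
    case (Suc n)
    define p q where "p = sqrt (V (Suc n))" and "q = sqrt (V n)"
    have p: "0 < p" "p\<^sup>2 = V (Suc n)" and q: "0 < q" "q\<^sup>2 = V n"
      using V_pos by (simp_all add: p_def q_def less_imp_le)
    have "V (Suc n) = V n + 1 / v (Suc n)" by (simp add: V_def)
    then have vpq: "1 / v (Suc n) = (p - q) * (p + q)"
      using p q by (simp add: algebra_simps power2_eq_square)
    then have "0 < (p - q) * (p + q)" using v[of "Suc n"] by (metis zero_less_divide_1_iff)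
    then have "q \<le> p" using p q by (simp add: zero_less_mult_iff)
    have "1 / (v (Suc n) * p) = (p - q) * (p + q) / p"
      using vpq by (metis divide_divide_eq_left)
    also have "\<dots> \<le> (p - q) * (2 * p) / p"
      using p q \<open>q \<le> p\<close> by (intro divide_right_mono mult_left_mono) auto
    also have "\<dots> = 2 * p - 2 * q" using p by simp
    finally show ?case using Suc.IH by (simp add: p_def q_def)
  qed
  have cs: "(\<Sum>k\<le>n. x k)\<^sup>2 \<le> 2 * sqrt (V n) * (\<Sum>k\<le>n. y k)" for n
  proof -
    define s where "s = (\<lambda>k. sqrt (v k * sqrt (V k)))"
    have s: "0 < s k" "(s k)\<^sup>2 = v k * sqrt (V k)" for k
      using v[of k] V_pos[of k] by (simp_all add: s_def)
    have "(\<Sum>k\<le>n. x k)\<^sup>2 = (\<Sum>k\<le>n. (s k * x k) * (1 / s k))\<^sup>2"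
      using s(1) by (simp add: less_imp_neq[symmetric])
    also have "\<dots> \<le> (\<Sum>k\<le>n. (s k * x k)\<^sup>2) * (\<Sum>k\<le>n. (1 / s k)\<^sup>2)"
      by (rule Cauchy_Schwarz_ineq_sum)
    also have "\<dots> = (\<Sum>k\<le>n. y k) * (\<Sum>k\<le>n. 1 / (v k * sqrt (V k)))"
      by (simp add: power_mult_distrib power_divide s(2) y_def)
    also have "\<dots> \<le> (\<Sum>k\<le>n. y k) * (2 * sqrt (V n))"
      using y_nonneg by (intro mult_left_mono inv_sum sum_nonneg) auto
    finally show ?thesis by (simp add: mult.commute)
  qed
  \<comment> \<open>The dual estimate: w is the decrement of W, a difference of squares of roots
    whose sum is at most 2 sqrt W. The product sqrt W sqrt V is then controlled by
    \<open>VC\<close>.\<close>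
  have w_le: "w n * sqrt (V n) \<le> 2 * sqrt C * (sqrt (W n) - sqrt (W (Suc n)))" for n
  proof -
    have le: "sqrt (W (Suc n)) \<le> sqrt (W n)" using W(2)[of n] w[of n] by simp
    have "w n = (sqrt (W n) - sqrt (W (Suc n))) * (sqrt (W n) + sqrt (W (Suc n)))"
      using W(1)[of n] W(1)[of "Suc n"] W(2)[of n]
      by (simp add: mult.commute[of "_ - _"] square_diff_square_factored[symmetric])
    then have "w n * sqrt (V n) = (sqrt (W n) - sqrt (W (Suc n))) * ((sqrt (W n) + sqrt (W (Suc n))) * sqrt (V n))"
      by (metis mult.assoc)
    also have "\<dots> \<le> (sqrt (W n) - sqrt (W (Suc n))) * (2 * (sqrt (W n) * sqrt (V n)))"
      using le V_pos[of n] mult_right_mono[of "sqrt (W n) + sqrt (W (Suc n))" "2 * sqrt (W n)" "sqrt (V n)"]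
      by (intro mult_left_mono) auto
    also have "\<dots> \<le> (sqrt (W n) - sqrt (W (Suc n))) * (2 * sqrt C)"
      using le VC by (intro mult_left_mono) auto
    finally show ?thesis by (simp add: mult_ac)
  qed
  \<comment> \<open>The induction carries out an interchange of summation: the coefficient of
    \<open>y k\<close> collects the differences of sqrt W from k to N - 1, which telescope.\<close>
  have "(\<Sum>n<N. w n * (\<Sum>k\<le>n. x k)\<^sup>2) \<le> (\<Sum>k<N. 4 * sqrt C * y k * (sqrt (W k) - sqrt (W N)))"
  proof (induction N)
    case (Suc N)
    let ?Y = "\<Sum>k\<le>N. y k" and ?d = "sqrt (W N) - sqrt (W (Suc N))"
    have "w N * (\<Sum>k\<le>N. x k)\<^sup>2 \<le> w N * (2 * sqrt (V N) * ?Y)"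
      by (intro mult_left_mono cs w)
    also have "\<dots> = 2 * ?Y * (w N * sqrt (V N))" by simp
    also have "\<dots> \<le> 2 * ?Y * (2 * sqrt C * ?d)"
      using y_nonneg by (intro mult_left_mono w_le) (simp add: sum_nonneg)
    also have "\<dots> = (\<Sum>k<N. 4 * sqrt C * y k * ?d) + 4 * sqrt C * y N * ?d"
    proof -
      have "?Y = (\<Sum>k<N. y k) + y N" by (simp add: lessThan_Suc_atMost[symmetric])
      moreover have "(\<Sum>k<N. 4 * sqrt C * y k * ?d) = 4 * sqrt C * (\<Sum>k<N. y k) * ?d"
        by (simp only: sum_distrib_left[symmetric] sum_distrib_right[symmetric])
      ultimately show ?thesis by (simp add: algebra_simps)
    qed
    finally have "(\<Sum>n<Suc N. w n * (\<Sum>k\<le>n. x k)\<^sup>2) \<le>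
        (\<Sum>k<N. 4 * sqrt C * y k * (sqrt (W k) - sqrt (W N))) +
        ((\<Sum>k<N. 4 * sqrt C * y k * ?d) + 4 * sqrt C * y N * ?d)"
      using Suc.IH by simp
    also have "\<dots> = (\<Sum>k<Suc N. 4 * sqrt C * y k * (sqrt (W k) - sqrt (W (Suc N))))"
    proof -
      have "(\<Sum>k<N. 4 * sqrt C * y k * (sqrt (W k) - sqrt (W N))) + (\<Sum>k<N. 4 * sqrt C * y k * ?d) =
          (\<Sum>k<N. 4 * sqrt C * y k * (sqrt (W k) - sqrt (W (Suc N))))"
        unfolding sum.distrib[symmetric] by (intro sum.cong refl) (simp add: algebra_simps)
      then show ?thesis by simp
    qed
    finally show ?case .
  qed simp
  also have "\<dots> \<le> (\<Sum>k<N. 4 * C * (v k * (x k)\<^sup>2))"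
  proof (rule sum_mono)
    fix k
    \<comment> \<open>After discarding sqrt (W N), the factor sqrt (V k) inside \<open>y k\<close>
      pairs with sqrt (W k), and a second use of \<open>VC\<close> completes sqrt C to C.\<close>
    have "4 * sqrt C * y k * (sqrt (W k) - sqrt (W N)) \<le> 4 * sqrt C * y k * sqrt (W k)"
      using y_nonneg[of k] C0 W(1)[of N] by (intro mult_left_mono) auto
    also have "\<dots> = 4 * sqrt C * (v k * (x k)\<^sup>2) * (sqrt (W k) * sqrt (V k))"
      by (simp add: y_def)
    also have "\<dots> \<le> 4 * sqrt C * (v k * (x k)\<^sup>2) * sqrt C"
      using C0 v[of k] by (intro mult_left_mono VC) auto
    also have "\<dots> = 4 * C * (v k * (x k)\<^sup>2)" using C0 by simp
    finally show "4 * sqrt C * y k * (sqrt (W k) - sqrt (W N)) \<le> 4 * C * (v k * (x k)\<^sup>2)" .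
  qed
  finally show ?thesis by (simp add: sum_distrib_left)
qed

section \<open>The cycle of implications between the three conditions\<close>

text \<open>All normalized kernels have norm 1, so the bound of the operator serves for every t at
  once.\<close>

lemma cesaro_bounded_imp_kernel_bounded:
  assumes "cesaro_bounded_on_dirichlet \<eta>"
  shows "(SUP t\<in>{0..<1::real}.
    cesaro_dirichlet_enorm \<eta> (normalized_dirichlet_kernel (complex_of_real t))) < \<infinity>"
proof -
  obtain C where wd: "\<And>f. f \<in> dirichlet_space \<Longrightarrow> cesaro_well_defined \<eta> f"
    and D: "\<And>f. f \<in> dirichlet_space \<Longrightarrow> cesaro \<eta> f \<in> dirichlet_space"
    and C: "\<And>f. f \<in> dirichlet_space \<Longrightarrow> dirichlet_norm (cesaro \<eta> f) \<le> C * dirichlet_norm f"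
    using assms unfolding cesaro_bounded_on_dirichlet_def by blast
  have "cesaro_dirichlet_enorm \<eta> (normalized_dirichlet_kernel (complex_of_real t)) \<le> ennreal C"
    if "t \<in> {0..<1}" for t
  proof -
    have t: "0 \<le> t" "t < 1" using that by auto
    note k = normalized_dirichlet_kernel_norm[OF t]
    show ?thesis
      using wd[OF k(1)] D[OF k(1)] C[OF k(1)] by (simp add: cesaro_dirichlet_enorm_def k(2) ennreal_leI)
  qed
  then have "(SUP t\<in>{0..<1::real}.
      cesaro_dirichlet_enorm \<eta> (normalized_dirichlet_kernel (complex_of_real t))) \<le> ennreal C"
    by (rule SUP_least)
  then show ?thesis
    by (rule le_less_trans) simp
qed

text \<open>Summability is concluded separately because \<open>suminf\<close> of a divergent series
  carries no information about its partial sums.\<close>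

lemma kernel_bounded_imp_tail_bound:
  assumes "(SUP t\<in>{0..<1::real}.
    cesaro_dirichlet_enorm \<eta> (normalized_dirichlet_kernel (complex_of_real t))) < \<infinity>"
  obtains C where "summable (\<lambda>n. real n * (norm (\<eta> n))\<^sup>2)"
    and "\<And>m. (\<Sum>n. real (n + m) * (norm (\<eta> (n + m)))\<^sup>2) \<le> C / ln (real m + 2)"
proof -
  define k where "k = (\<lambda>t. normalized_dirichlet_kernel (complex_of_real t))"
  define M where "M = enn2real (SUP t\<in>{0..<1::real}. cesaro_dirichlet_enorm \<eta> (k t))"
  have M: "(SUP t\<in>{0..<1::real}. cesaro_dirichlet_enorm \<eta> (k t)) = ennreal M"
    using assms by (simp add: M_def k_def less_top)
  \<comment> \<open>The 3 comes from the bound for K_t(t), the square of e from the lower bound for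
    the partial sums, and \<open>M\<close> from the hypothesis.\<close>
  define C where "C = 3 * M\<^sup>2 * (exp 1)\<^sup>2"
  \<comment> \<open>Finite blocks come first: a bound free of \<open>N\<close> gives summability
    from m = 0 and then the tail estimate for every \<open>m\<close>.\<close>
  have partial: "(\<Sum>n\<in>{m..<N}. real n * (norm (\<eta> n))\<^sup>2) \<le> C / ln (real m + 2)" for m N
  proof -
    define t where "t = real (m + 1) / real (m + 2)"
    define K where "K = Re (dirichlet_kernel (complex_of_real t) (complex_of_real t))"
    define L where "L = ln (real m + 2)"
    define S where "S = (\<lambda>n. \<Sum>j\<le>n. t ^ j / dirichlet_weight j)"
    have t: "0 \<le> t" "t < 1" by (simp_all add: t_def)
    have L: "0 < L" by (simp add: L_def)
    have K: "0 < K" "K \<le> 3 * L"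
      using dirichlet_kernel_diag_pos[OF t] dirichlet_kernel_diag_le[of m] by (simp_all add: K_def t_def L_def)
    have le: "cesaro_dirichlet_enorm \<eta> (k t) \<le> ennreal M"
      unfolding M[symmetric] by (rule SUP_upper) (use t in auto)
    \<comment> \<open>A finite value rules out the infinite branch of
      \<open>cesaro_dirichlet_enorm\<close>, which is what makes the image a genuine element of the
      space.\<close>
    then have wd: "cesaro_well_defined \<eta> (k t)" and D: "cesaro \<eta> (k t) \<in> dirichlet_space"
      by (auto simp: cesaro_dirichlet_enorm_def top_unique split: if_splits)
    have norm: "dirichlet_norm (cesaro \<eta> (k t)) \<le> M"
      using le wd D by (simp add: cesaro_dirichlet_enorm_def M_def)
    have coeff: "fps_nth (fps_expansion (cesaro \<eta> (k t)) 0) n = \<eta> n * complex_of_real (S n / sqrt K)" for n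
    proof -
      have "fps_nth (fps_expansion (k t) 0) j = complex_of_real (t ^ j / dirichlet_weight j / sqrt K)" for j
        unfolding k_def K_def by (rule normalized_dirichlet_kernel_coeffs(2)[OF t])
      then show ?thesis
        unfolding cesaro_coeffs[OF wd] cesaro_coeff_def S_def sum_divide_distrib of_real_sum by simp
    qed
    have sq: "(norm (fps_nth (fps_expansion (cesaro \<eta> (k t)) 0) n))\<^sup>2 = (norm (\<eta> n))\<^sup>2 * (S n)\<^sup>2 / K" for n
      using K unfolding coeff norm_mult norm_of_real by (simp add: power_mult_distrib power_divide)
    note sums = dirichlet_norm_sums[OF D, unfolded sq]
    have S_ge: "exp (-1) * L \<le> S n" if "m \<le> n" for n
      using kernel_partial_sum_ge[OF that] by (simp add: L_def S_def t_def)
    \<comment> \<open>On the block every n is at least m, so \<open>S n\<close> may be replaced by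
      its lower bound; the block is then a part of the squared norm of the image.\<close>
    have "(exp (-1) * L)\<^sup>2 / K * (\<Sum>n\<in>{m..<N}. real n * (norm (\<eta> n))\<^sup>2)
        = (\<Sum>n\<in>{m..<N}. real n * ((norm (\<eta> n))\<^sup>2 * (exp (-1) * L)\<^sup>2 / K))"
      by (simp add: sum_distrib_left mult_ac)
    also have "\<dots> \<le> (\<Sum>n\<in>{m..<N}. dirichlet_weight n * ((norm (\<eta> n))\<^sup>2 * (S n)\<^sup>2 / K))"
      using S_ge L K
      by (intro sum_mono mult_mono divide_right_mono power_mono) (auto simp: dirichlet_weight_def)
    also have "\<dots> \<le> (dirichlet_norm (cesaro \<eta> (k t)))\<^sup>2"
      using K by (subst sums_unique[OF sums], intro sum_le_suminf sums_summable[OF sums])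
        (auto simp: dirichlet_weight_pos less_imp_le)
    also have "\<dots> \<le> M\<^sup>2"
      using norm by (intro power_mono) (auto simp: dirichlet_norm_def)
    finally have "(exp (-1) * L)\<^sup>2 / K * (\<Sum>n\<in>{m..<N}. real n * (norm (\<eta> n))\<^sup>2) \<le> M\<^sup>2" .
    then have "(\<Sum>n\<in>{m..<N}. real n * (norm (\<eta> n))\<^sup>2) \<le> M\<^sup>2 / ((exp (-1) * L)\<^sup>2 / K)"
      using K L by (subst pos_le_divide_eq) (simp_all add: mult.commute)
    also have "\<dots> = M\<^sup>2 * (exp 1)\<^sup>2 * K / L\<^sup>2"
      by (simp add: exp_minus power_mult_distrib field_simps)
    also have "\<dots> \<le> M\<^sup>2 * (exp 1)\<^sup>2 * (3 * L) / L\<^sup>2"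
      using K by (intro divide_right_mono mult_left_mono) auto
    also have "\<dots> = C / L" by (simp add: C_def power2_eq_square)
    finally show ?thesis by (simp add: L_def)
  qed
  have sm: "summable (\<lambda>n. real n * (norm (\<eta> n))\<^sup>2)"
  proof (rule bounded_imp_summable)
    fix N
    have "(\<Sum>n\<in>{0..<Suc N}. real n * (norm (\<eta> n))\<^sup>2) \<le> C / ln (real 0 + 2)" by (rule partial)
    then show "(\<Sum>n\<le>N. real n * (norm (\<eta> n))\<^sup>2) \<le> C / ln (real 0 + 2)"
      by (simp only: atLeast0LessThan lessThan_Suc_atMost)
  qed simp
  have "(\<Sum>n. real (n + m) * (norm (\<eta> (n + m)))\<^sup>2) \<le> C / ln (real m + 2)" for m
  proof (rule suminf_le_const)
    show "summable (\<lambda>n. real (n + m) * (norm (\<eta> (n + m)))\<^sup>2)"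
      using sm by (rule summable_ignore_initial_segment)
    fix N
    show "(\<Sum>n<N. real (n + m) * (norm (\<eta> (n + m)))\<^sup>2) \<le> C / ln (real m + 2)"
      using partial[of m "N + m"] sum.shift_bounds_nat_ivl[of "\<lambda>n. real n * (norm (\<eta> n))\<^sup>2" 0 m N]
      by (simp add: atLeast0LessThan)
  qed
  with sm show thesis by (rule that)
qed

text \<open>The Hardy inequality with w n = n |\<eta>_n|^2 controls all coefficients of the image
  but the constant one, where this weight vanishes; that coefficient is estimated directly.\<close>

lemma tail_bound_imp_cesaro_bounded:
  assumes sm: "summable (\<lambda>n. real n * (norm (\<eta> n))\<^sup>2)"
    and tail: "\<And>m. (\<Sum>n. real (n + m) * (norm (\<eta> (n + m)))\<^sup>2) \<le> C / ln (real m + 2)"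
  shows "cesaro_bounded_on_dirichlet \<eta>"
proof -
  define w where "w = (\<lambda>n. real n * (norm (\<eta> n))\<^sup>2)"
  define W where "W = (\<lambda>m. \<Sum>n. w (n + m))"
  have w: "0 \<le> w n" for n by (simp add: w_def)
  have smw: "summable (\<lambda>n. w (n + m))" for m
    using sm unfolding w_def by (rule summable_ignore_initial_segment)
  have W0: "0 \<le> W m" for m
    unfolding W_def using w smw by (intro suminf_nonneg) auto
  have W_Suc: "W m = w m + W (Suc m)" for m
    using suminf_split_head[OF smw[of m]] by (simp add: W_def)
  have WV: "W m * (\<Sum>k\<le>m. 1 / dirichlet_weight k) \<le> 5 * C" for m
  proof -
    have "W m * weight_sum m \<le> W m * (5 * ln (real m + 2))"
      by (intro mult_left_mono weight_sum_bounds W0)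
    also have "\<dots> \<le> C / ln (real m + 2) * (5 * ln (real m + 2))"
      using tail[of m] by (intro mult_right_mono) (simp_all add: W_def w_def)
    also have "\<dots> = 5 * C"
    proof -
      have "0 < ln (real m + 2)" by simp
      then show ?thesis by simp
    qed
    finally show ?thesis by (simp add: weight_sum_def)
  qed
  \<comment> \<open>The first summand pays for the constant coefficient. The 20 is the 4 of the
    Hardy inequality times the 5 from \<open>weight_sum_bounds\<close>.\<close>
  define B where "B = (norm (\<eta> 0))\<^sup>2 + 20 * C"
  have "0 \<le> C / ln (real 0 + 2)"
    using W0[of 0] tail[of 0] by (simp add: W_def w_def)
  then have "0 \<le> C"
    by (simp add: zero_le_divide_iff)
  then have "0 \<le> B" by (simp add: B_def)
  have main: "cesaro_well_defined \<eta> f \<and> cesaro \<eta> f \<in> dirichlet_space \<and>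
      dirichlet_norm (cesaro \<eta> f) \<le> sqrt B * dirichlet_norm f"
    if f: "f \<in> dirichlet_space" for f
  proof -
    define a where "a = fps_nth (fps_expansion f 0)"
    define c where "c = cesaro_coeff \<eta> f"
    have a_sums: "(\<lambda>n. dirichlet_weight n * (norm (a n))\<^sup>2) sums (dirichlet_norm f)\<^sup>2"
      unfolding a_def by (rule dirichlet_norm_sums[OF f])
    \<comment> \<open>The Hardy inequality concerns real sequences, so the triangle inequality first
      replaces the coefficients by their moduli.\<close>
    have c_le: "(norm (c n))\<^sup>2 \<le> (norm (\<eta> n))\<^sup>2 * (\<Sum>k\<le>n. norm (a k))\<^sup>2" for n
      unfolding c_def cesaro_coeff_def a_def[symmetric] norm_mult power_mult_distrib
      by (intro mult_left_mono power_mono norm_sum) auto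
    have partial: "(\<Sum>n<N. real n * (norm (c n))\<^sup>2) \<le> 20 * C * (dirichlet_norm f)\<^sup>2" for N
    proof -
      have "(\<Sum>n<N. real n * (norm (c n))\<^sup>2) \<le> (\<Sum>n<N. w n * (\<Sum>k\<le>n. norm (a k))\<^sup>2)"
        using mult_left_mono[OF c_le] by (intro sum_mono) (simp add: w_def mult.assoc)
      also have "\<dots> \<le> 4 * (5 * C) * (\<Sum>k<N. dirichlet_weight k * (norm (a k))\<^sup>2)"
        by (rule weighted_hardy_inequality[OF dirichlet_weight_pos w W0 W_Suc WV])
      also have "\<dots> \<le> 4 * (5 * C) * (dirichlet_norm f)\<^sup>2"
        using \<open>0 \<le> C\<close> unfolding sums_unique[OF a_sums]
        by (intro mult_left_mono sum_le_suminf sums_summable[OF a_sums])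
          (auto simp: dirichlet_weight_pos less_imp_le)
      finally show ?thesis by simp
    qed
    have smc: "summable (\<lambda>n. real n * (norm (c n))\<^sup>2)"
    proof (rule bounded_imp_summable)
      show "(\<Sum>n\<le>N. real n * (norm (c n))\<^sup>2) \<le> 20 * C * (dirichlet_norm f)\<^sup>2" for N
        using partial[of "Suc N"] by (simp only: lessThan_Suc_atMost)
    qed simp
    \<comment> \<open>For n \<ge> 1 the n-th term of the bounded partial sums dominates |c_n|^2. At
      n = 0 the factor n vanishes, so |c_0| enters the bound itself.\<close>
    have "norm (c n) \<le> max (norm (c 0)) (sqrt (20 * C * (dirichlet_norm f)\<^sup>2))" for n
    proof (cases "n = 0")
      case False
      have "(norm (c n))\<^sup>2 \<le> real n * (norm (c n))\<^sup>2"
        using False by (simp add: mult_le_cancel_right1)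
      also have "\<dots> \<le> (\<Sum>j<Suc n. real j * (norm (c j))\<^sup>2)"
        by (intro member_le_sum) auto
      also have "\<dots> \<le> 20 * C * (dirichlet_norm f)\<^sup>2" by (rule partial)
      finally show ?thesis using real_le_rsqrt by (simp add: le_max_iff_disj)
    qed simp
    then have wd: "cesaro_well_defined \<eta> f"
      unfolding c_def by (rule cesaro_well_defined_of_bounded)
    have coeff: "fps_nth (fps_expansion (cesaro \<eta> f) 0) n = c n" for n
      by (simp add: cesaro_coeffs[OF wd] c_def)
    have D: "cesaro \<eta> f \<in> dirichlet_space"
      using wd smc by (simp add: dirichlet_space_iff coeff cesaro_well_defined_def)
    have c_sums: "(\<lambda>n. dirichlet_weight n * (norm (c n))\<^sup>2) sums (dirichlet_norm (cesaro \<eta> f))\<^sup>2"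
      using dirichlet_norm_sums[OF D] by (simp add: coeff)
    have "(dirichlet_norm (cesaro \<eta> f))\<^sup>2 \<le> B * (dirichlet_norm f)\<^sup>2"
      unfolding sums_unique[OF c_sums]
    proof (rule suminf_le_const[OF sums_summable[OF c_sums]])
      fix N
      have "(\<Sum>n<N. dirichlet_weight n * (norm (c n))\<^sup>2) \<le>
          (\<Sum>n<N. (if n = 0 then (norm (c 0))\<^sup>2 else 0) + real n * (norm (c n))\<^sup>2)"
        by (intro sum_mono) (simp add: dirichlet_weight_def)
      also have "\<dots> \<le> (norm (c 0))\<^sup>2 + (\<Sum>n<N. real n * (norm (c n))\<^sup>2)"
        by (simp add: sum.distrib)
      also have "(norm (c 0))\<^sup>2 \<le> (norm (\<eta> 0))\<^sup>2 * (norm (a 0))\<^sup>2"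
        using c_le[of 0] by simp
      also have "(norm (a 0))\<^sup>2 \<le> (dirichlet_norm f)\<^sup>2"
        using sum_le_suminf[OF sums_summable[OF a_sums], of "{0}"]
        unfolding sums_unique[OF a_sums] by (simp add: dirichlet_weight_pos less_imp_le) (simp add: dirichlet_weight_def)
      finally have "(\<Sum>n<N. dirichlet_weight n * (norm (c n))\<^sup>2) \<le>
          (norm (\<eta> 0))\<^sup>2 * (dirichlet_norm f)\<^sup>2 + (\<Sum>n<N. real n * (norm (c n))\<^sup>2)"
        by (simp add: mult_left_mono)
      with partial[of N] show "(\<Sum>n<N. dirichlet_weight n * (norm (c n))\<^sup>2) \<le> B * (dirichlet_norm f)\<^sup>2"
        by (simp add: B_def distrib_right)
    qed
    then have "dirichlet_norm (cesaro \<eta> f) \<le> sqrt (B * (dirichlet_norm f)\<^sup>2)"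
      by (rule real_le_rsqrt)
    also have "\<dots> = sqrt B * dirichlet_norm f"
      by (simp add: real_sqrt_mult dirichlet_norm_def)
    finally show ?thesis using wd D by blast
  qed
  \<comment> \<open>Boundedness asks for a strictly positive constant, while \<open>B\<close> may be
    0; hence the added 1.\<close>
  have "cesaro \<eta> f \<in> dirichlet_space \<and> dirichlet_norm (cesaro \<eta> f) \<le> (sqrt B + 1) * dirichlet_norm f"
    if "f \<in> dirichlet_space" for f
    using main[OF that] by (simp add: distrib_right) (simp add: dirichlet_norm_def add_increasing2)
  moreover have "0 < sqrt B + 1" using \<open>0 \<le> B\<close> by (simp add: add_nonneg_pos)
  ultimately show ?thesis
    using main unfolding cesaro_bounded_on_dirichlet_def by blast
qed

theorem theorem1p3:
  fixes \<eta> :: "nat \<Rightarrow> complex"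
  shows
    "(cesaro_bounded_on_dirichlet \<eta> \<longleftrightarrow>
       (SUP t\<in>{0..<1::real}.
          cesaro_dirichlet_enorm \<eta> (normalized_dirichlet_kernel (complex_of_real t))) < \<infinity>) \<and>
     ((SUP t\<in>{0..<1::real}.
          cesaro_dirichlet_enorm \<eta> (normalized_dirichlet_kernel (complex_of_real t))) < \<infinity> \<longleftrightarrow>
       summable (\<lambda>n. real n * (norm (\<eta> n))\<^sup>2) \<and>
       (\<exists>C::real. \<forall>m::nat.
          (\<Sum>n. real (n + m) * (norm (\<eta> (n + m)))\<^sup>2) \<le> C / ln (real m + 2)))"
    (is "(?i \<longleftrightarrow> ?ii) \<and> (?ii \<longleftrightarrow> ?iii)")
proof -
  have "?i \<Longrightarrow> ?ii" by (rule cesaro_bounded_imp_kernel_bounded)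
  moreover have "?ii \<Longrightarrow> ?iii" by (elim kernel_bounded_imp_tail_bound) blast
  moreover have "?iii \<Longrightarrow> ?i" using tail_bound_imp_cesaro_bounded by blast
  ultimately show ?thesis by blast
qed

end
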